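(* Let $p:\mathbb{H}\to\mathbb{H}$, $p(\lambda)=\sum_{i=0}^m a_i\lambda^i$ with $a_i\in\mathbb{H}$, be a quaternion scalar polynomial and let $\Omega$ be any subset of $\mathbb{H}$. Then $p(\lambda)$ is hyperstable with respect to $\Omega$ if and only if $p(\lambda)$ is stable with respect to $\Omega$.
   Context: $\mathbb{H}$ denotes the real quaternions; for $z\in\mathbb{H}$, $z^*=\overline{z}$ is the quaternion conjugate. $p(\lambda)=\sum_{i=0}^m a_i\lambda^i$ is stable with respect to $\Omega$ if for every nonzero $y\in\mathbb{H}$ and every $\mu\in\Omega$ there is a nonzero $z\in\mathbb{H}$ with $\sum_{i=0}^m z^*a_i y\mu^i\neq 0$. It is hyperstable with respect to $\Omega$ if for every nonzero $y\in\mathbb{H}$ there is a nonzero $z\in\mathbb{H}$ with $\sum_{i=0}^m z^*a_i y\mu^i\neq0$ for all $\mu\in\Omega$. *)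

theory Defs
  imports Complex_Main
begin

section \<open>The real quaternions\<close>

text \<open>The value \<open>Quat a b c d\<close> stands for a + b i + c j + d k.\<close>

datatype quat = Quat (qre: real) (qi: real) (qj: real) (qk: real)

lemma quat_eq_iff:
  "x = y \<longleftrightarrow> qre x = qre y \<and> qi x = qi y \<and> qj x = qj y \<and> qk x = qk y"
  by (cases x; cases y) simp

definition qcnj :: "quat \<Rightarrow> quat" where
  "qcnj x = Quat (qre x) (- qi x) (- qj x) (- qk x)"

definition qnormsq :: "quat \<Rightarrow> real" where
  "qnormsq x = (qre x)\<^sup>2 + (qi x)\<^sup>2 + (qj x)\<^sup>2 + (qk x)\<^sup>2"

lemma qcnj_sel [simp]:
  "qre (qcnj x) = qre x" "qi (qcnj x) = - qi x"
  "qj (qcnj x) = - qj x" "qk (qcnj x) = - qk x"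
  by (simp_all add: qcnj_def)

lemma qnormsq_eq_0_iff:
  "qnormsq x = 0 \<longleftrightarrow> qre x = 0 \<and> qi x = 0 \<and> qj x = 0 \<and> qk x = 0"
  by (simp add: qnormsq_def add_nonneg_eq_0_iff)

instantiation quat :: ring_1
begin

definition "0 = Quat 0 0 0 0"
definition "1 = Quat 1 0 0 0"
definition "x + y = Quat (qre x + qre y) (qi x + qi y) (qj x + qj y) (qk x + qk y)"
definition "- x = Quat (- qre x) (- qi x) (- qj x) (- qk x)"
definition "x - y = Quat (qre x - qre y) (qi x - qi y) (qj x - qj y) (qk x - qk y)"
definition "x * y = Quat
  (qre x * qre y - qi x * qi y - qj x * qj y - qk x * qk y)
  (qre x * qi y + qi x * qre y + qj x * qk y - qk x * qj y)
  (qre x * qj y - qi x * qk y + qj x * qre y + qk x * qi y)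
  (qre x * qk y + qi x * qj y - qj x * qi y + qk x * qre y)"

instance
  by standard
    (simp_all add: zero_quat_def one_quat_def plus_quat_def uminus_quat_def
      minus_quat_def times_quat_def algebra_simps)

end

instantiation quat :: division_ring
begin

definition "inverse x = Quat (qre x / qnormsq x) (- qi x / qnormsq x)
  (- qj x / qnormsq x) (- qk x / qnormsq x)"
definition "x div y = x * inverse (y :: quat)"

instance
proof
  fix x y :: quat
  show "inverse (0 :: quat) = 0"
    by (simp add: inverse_quat_def zero_quat_def)
  show "x div y = x * inverse y"
    by (rule divide_quat_def)
  assume "x \<noteq> 0"
  then have nz: "qnormsq x \<noteq> 0"
    by (auto simp: qnormsq_eq_0_iff zero_quat_def quat_eq_iff)
  have sq: "qre x * qre x + qi x * qi x + qj x * qj x + qk x * qk x = qnormsq x"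
    by (simp add: qnormsq_def power2_eq_square)
  show "inverse x * x = 1"
    using nz sq by (simp add: inverse_quat_def times_quat_def one_quat_def field_simps)
  show "x * inverse x = 1"
    using nz sq by (simp add: inverse_quat_def times_quat_def one_quat_def field_simps)
qed

end

lemma quat_units:
  defines "i \<equiv> Quat 0 1 0 0" and "j \<equiv> Quat 0 0 1 0" and "k \<equiv> Quat 0 0 0 1"
  shows "i * i = - 1" "j * j = - 1" "k * k = - 1" "i * j * k = - 1"
  by (simp_all add: i_def j_def k_def times_quat_def uminus_quat_def one_quat_def)

lemma qcnj_mult: "qcnj (x * y) = qcnj y * qcnj x"
  by (simp add: quat_eq_iff times_quat_def algebra_simps)

section \<open>Stability and hyperstability\<close>

text \<open>
  The polynomial \<open>\<Sum>i\<le>m. a i * \<lambda> ^ i\<close> is given by \<open>m\<close> and its coefficient sequence \<open>a\<close>, of which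
  only the values \<open>a 0\<close>, ..., \<open>a m\<close> matter; \<open>a m\<close> may be zero.
  As the quaternions do not commute, the direction \<open>y\<close> is inserted between \<open>a i\<close> and
  the power of \<open>\<mu>\<close>, so the sums below do not factor through the value of the polynomial at \<open>\<mu>\<close>.
\<close>

definition stable_wrt :: "nat \<Rightarrow> (nat \<Rightarrow> quat) \<Rightarrow> quat set \<Rightarrow> bool" where
  "stable_wrt m a \<Omega> \<longleftrightarrow>
    (\<forall>y. y \<noteq> 0 \<longrightarrow> (\<forall>\<mu>\<in>\<Omega>. \<exists>z. z \<noteq> 0 \<and> (\<Sum>i\<le>m. qcnj z * a i * y * \<mu> ^ i) \<noteq> 0))"

definition hyperstable_wrt :: "nat \<Rightarrow> (nat \<Rightarrow> quat) \<Rightarrow> quat set \<Rightarrow> bool" where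
  "hyperstable_wrt m a \<Omega> \<longleftrightarrow>
    (\<forall>y. y \<noteq> 0 \<longrightarrow> (\<exists>z. z \<noteq> 0 \<and> (\<forall>\<mu>\<in>\<Omega>. (\<Sum>i\<le>m. qcnj z * a i * y * \<mu> ^ i) \<noteq> 0)))"

end

theory Submission
  imports Defs
begin

text \<open>
  The test vector \<open>z\<close> enters every summand as the left factor \<open>qcnj z\<close>, so the sum is
  \<open>qcnj z * (\<Sum>i\<le>m. a i * y * \<mu> ^ i)\<close>. The quaternions have no zero divisors, hence for
  \<open>z \<noteq> 0\<close> whether the sum vanishes does not depend on \<open>z\<close>. The quantifier over \<open>z\<close> can
  therefore be moved across the one over \<open>\<mu>\<close>, with \<open>z = 1\<close> as a common witness, and both notions say that
  \<open>\<Sum>i\<le>m. a i * y * \<mu> ^ i\<close> is nonzero for all \<open>y \<noteq> 0\<close> and \<open>\<mu> \<in> \<Omega>\<close>.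
\<close>

lemma qcnj_eq_0_iff: "qcnj z = 0 \<longleftrightarrow> z = 0"
  by (simp add: quat_eq_iff zero_quat_def)

lemma sum_qcnj_eq_0_iff:
  assumes "z \<noteq> 0"
  shows "(\<Sum>i\<le>m. qcnj z * a i * y * \<mu> ^ i) = 0 \<longleftrightarrow> (\<Sum>i\<le>m. a i * y * \<mu> ^ i) = 0"
proof -
  have "(\<Sum>i\<le>m. qcnj z * a i * y * \<mu> ^ i) = qcnj z * (\<Sum>i\<le>m. a i * y * \<mu> ^ i)"
    by (simp add: sum_distrib_left mult.assoc)
  with assms show ?thesis
    by (simp add: qcnj_eq_0_iff)
qed

theorem theorem4p25:
  fixes m :: nat and a :: "nat \<Rightarrow> quat" and \<Omega> :: "quat set"
  shows "hyperstable_wrt m a \<Omega> \<longleftrightarrow> stable_wrt m a \<Omega>"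
proof
  assume "hyperstable_wrt m a \<Omega>"
  then show "stable_wrt m a \<Omega>"
    unfolding hyperstable_wrt_def stable_wrt_def by blast
next
  assume stable: "stable_wrt m a \<Omega>"
  show "hyperstable_wrt m a \<Omega>"
    unfolding hyperstable_wrt_def
  proof (intro allI impI exI conjI ballI)
    show "(1 :: quat) \<noteq> 0"
      by simp
    fix y \<mu> :: quat
    assume "y \<noteq> 0" and "\<mu> \<in> \<Omega>"
    with stable obtain z where "z \<noteq> 0" and "(\<Sum>i\<le>m. qcnj z * a i * y * \<mu> ^ i) \<noteq> 0"
      unfolding stable_wrt_def by blast
    then show "(\<Sum>i\<le>m. qcnj 1 * a i * y * \<mu> ^ i) \<noteq> 0"
      using sum_qcnj_eq_0_iff[of z] sum_qcnj_eq_0_iff[of 1] by simp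
  qed
qed

end
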